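(* Let $\sigma$ be an argumentation semantics, $\mathcal V=(V_a)_{a\in\mathcal A}$ an arbitrary basis and $\phi\in\mathcal L$. Then the point $(\emptyset,\emptyset)$ of $K^\sigma_{\mathcal V}$ and the point $(\emptyset,\emptyset)$ of $K^\sigma_{\rho_\phi(\mathcal V)}$ are $d(\phi)$-bisimilar modulo $\Pi_\phi$.
   Context: An argumentation framework (AF) is a digraph $(S,E)$ with $E\subseteq S\times S$. An argumentation semantics $\sigma$ assigns to each AF $(S,E)$ a set $\sigma(S,E)\subseteq 2^S$. Fix a finite nonempty set $\mathcal A$ of agents and a countably infinite set $\Pi$ of arguments. A basis is a family $\mathcal V=(V_a)_{a\in\mathcal A}$ with $V_a\subseteq\Pi\times\Pi$; $V_a|_T=V_a\cap(T\times T)$. Deliberative Kripke model $K^\sigma_{\mathcal V}=(C_{\mathcal V},R_{\mathcal V},\pi_\sigma)$: $C_{\mathcal V}$ is the set of pairs $q=(q_S,q_E)$ with $q_S\subseteq\Pi$, $\bigcap_aV_a|_{q_S}\subseteq q_E\subseteq\bigcup_aV_a|_{q_S}$. For $p\in\Pi$: $U(q,p)=\{X\mid\bigcap_aV_a|_{q_S\cup\{p\}}\subseteq X\subseteq\bigcup_aV_a|_{q_S\cup\{p\}}\}$, $succ(p,q)=\{(q_S\cup\{p\},q_E\cup X)\mid X\in U(q,p)\}$, $succ(q)=\bigcup_psucc(p,q)$; $R_{\mathcal V}(p)=\{(q,q')\mid q'\in succ(p,q)\}$, $R_{\mathcal V}(\exists)=\{(q,q')\mid q'\in succ(q)\}$.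 $\pi_\sigma(q)$ is the set of three-partitions $(\pi_1,\pi_0,\pi_{1/2})$ of $\Pi$ with $\pi_1\in\sigma(q_S,q_E)$, $\pi_0=\{p\in q_S\mid\exists r\in\pi_1:(r,p)\in q_E\}$. Language $\mathcal L$: inner formulas $\alpha::=p\mid\neg\alpha\mid\alpha\to\alpha$ ($p\in\Pi$); outer formulas $\phi::=\langle c\rangle\alpha\mid\neg\phi\mid\phi\wedge\phi\mid\langle p\rangle\phi\mid\Diamond\phi$. White modal depth: $d(\langle c\rangle\alpha)=0$, $d(\neg\phi)=d(\phi)$, $d(\phi\wedge\psi)=\max(d(\phi),d(\psi))$, $d(\Diamond\phi)=d(\langle p\rangle\phi)=1+d(\phi)$. $\Pi_\phi$ is the set of arguments occurring in $\phi$ inside inner subformulas. $n$-vicinity: $D(\mathcal V,\Phi,0)=\Phi$, $D(\mathcal V,\Phi,n+1)=D(\mathcal V,\Phi,n)\cup\{p\in\Pi\mid\exists r\in D(\mathcal V,\Phi,n):\{(p,r),(r,p)\}\cap\bigcup_aV_a\neq\emptyset\}$. Shrinking: with $D=D(\mathcal V,\Pi_\phi,d(\phi))$, $\rho_\phi(\mathcal V)=(V_a\cap(D\times D))_{a\in\mathcal A}$. For a point $q$ and $\Phi\subseteq\Pi$, $C(q,\Phi)$ is the digraph consisting of all connected components (ignoring edge direction) of $(q_S,q_E)$ containing an argument of $\Phi$. $n$-bisimulation modulo $\Phi$: for models $K=K^\sigma_{\mathcal V}$, $K'=K^\sigma_{\mathcal V'}$ and points $q\in C_{\mathcal V}$,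 $q'\in C_{\mathcal V'}$, we say $q,q'$ are $n$-bisimilar modulo $\Phi$ if there are relations $Z_n\subseteq Z_{n-1}\subseteq\dots\subseteq Z_0\subseteq C_{\mathcal V}\times C_{\mathcal V'}$ with (1) $qZ_nq'$; (2) if $vZ_0v'$ then $C(v,\Phi)=C(v',\Phi)$; (3) if $vZ_{i+1}v'$ and $(v,u)\in R_{\mathcal V}(s)$ for a symbol $s\in\Pi\cup\{\exists\}$, then there is $u'$ with $(v',u')\in R_{\mathcal V'}(s)$ and $uZ_iu'$; (4) symmetrically, if $vZ_{i+1}v'$ and $(v',u')\in R_{\mathcal V'}(s)$, then there is $u$ with $(v,u)\in R_{\mathcal V}(s)$ and $uZ_iu'$. *)

theory Defs
  imports "HOL-Library.Countable" "HOL-Library.Infinite_Typeclass"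
begin

text \<open>The set of arguments is the universe of a type \<open>'p\<close>, the set of agents the universe of a type
  \<open>'a\<close>; their cardinalities are prescribed by sort constraints where they matter.\<close>

type_synonym 'p graph = "'p set \<times> ('p \<times> 'p) set"

definition af :: "'p graph \<Rightarrow> bool" where
  "af F \<longleftrightarrow> snd F \<subseteq> fst F \<times> fst F"

text \<open>A semantics is only constrained on argumentation frameworks; its values on pairs \<open>(S, E)\<close>
  with \<open>E\<close> not contained in \<open>S \<times> S\<close>, which never are points of a model, are arbitrary.\<close>

definition argumentation_semantics :: "('p graph \<Rightarrow> 'p set set) \<Rightarrow> bool" where
  "argumentation_semantics \<sigma> \<longleftrightarrow> (\<forall>F. af F \<longrightarrow> \<sigma> F \<subseteq> Pow (fst F))"

type_synonym ('a, 'p) basis = "'a \<Rightarrow> ('p \<times> 'p) set"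

definition restr :: "('p \<times> 'p) set \<Rightarrow> 'p set \<Rightarrow> ('p \<times> 'p) set" where
  "restr E T = E \<inter> (T \<times> T)"

definition points :: "('a, 'p) basis \<Rightarrow> 'p graph set" where
  "points V = {(S, E). (\<Inter>a. restr (V a) S) \<subseteq> E \<and> E \<subseteq> (\<Union>a. restr (V a) S)}"

definition updates :: "('a, 'p) basis \<Rightarrow> 'p graph \<Rightarrow> 'p \<Rightarrow> ('p \<times> 'p) set set" where
  "updates V q p = {X. (\<Inter>a. restr (V a) (fst q \<union> {p})) \<subseteq> X \<and>
                       X \<subseteq> (\<Union>a. restr (V a) (fst q \<union> {p}))}"

definition succ_arg :: "('a, 'p) basis \<Rightarrow> 'p \<Rightarrow> 'p graph \<Rightarrow> 'p graph set" where
  "succ_arg V p q = {(fst q \<union> {p}, snd q \<union> X) | X. X \<in> updates V q p}"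

definition succ_any :: "('a, 'p) basis \<Rightarrow> 'p graph \<Rightarrow> 'p graph set" where
  "succ_any V q = (\<Union>p. succ_arg V p q)"

datatype 'p symbol = Arg 'p | Exists

fun accessibility :: "('a, 'p) basis \<Rightarrow> 'p symbol \<Rightarrow> ('p graph \<times> 'p graph) set" where
  "accessibility V (Arg p) = {(q, q'). q \<in> points V \<and> q' \<in> succ_arg V p q}"
| "accessibility V Exists = {(q, q'). q \<in> points V \<and> q' \<in> succ_any V q}"

text \<open>A triple \<open>(A, B, C)\<close> stands for \<open>(\<pi>\<^sub>1, \<pi>\<^sub>0, \<pi>\<^sub>1\<^sub>/\<^sub>2)\<close>; parts may be empty.\<close>

definition three_partition :: "'p set \<times> 'p set \<times> 'p set \<Rightarrow> bool" where
  "three_partition = (\<lambda>(A, B, C).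
     A \<union> B \<union> C = UNIV \<and> A \<inter> B = {} \<and> A \<inter> C = {} \<and> B \<inter> C = {})"

definition labellings ::
  "('p graph \<Rightarrow> 'p set set) \<Rightarrow> 'p graph \<Rightarrow> ('p set \<times> 'p set \<times> 'p set) set" where
  "labellings \<sigma> q = {(A, B, C). three_partition (A, B, C) \<and> A \<in> \<sigma> q \<and>
                                 B = {p \<in> fst q. \<exists>r \<in> A. (r, p) \<in> snd q}}"

record 'p kripke =
  worlds :: "'p graph set"
  rel :: "'p symbol \<Rightarrow> ('p graph \<times> 'p graph) set"
  val :: "'p graph \<Rightarrow> ('p set \<times> 'p set \<times> 'p set) set"

definition deliberative_model ::
  "('p graph \<Rightarrow> 'p set set) \<Rightarrow> ('a, 'p) basis \<Rightarrow> 'p kripke" where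
  "deliberative_model \<sigma> V = \<lparr>worlds = points V, rel = accessibility V, val = labellings \<sigma>\<rparr>"

datatype 'p inner = Atom 'p | INot "'p inner" | IImp "'p inner" "'p inner"

datatype 'p outer =
    DiaC "'p inner"
  | ONot "'p outer"
  | OAnd "'p outer" "'p outer"
  | DiaArg 'p "'p outer"
  | Dia "'p outer"

primrec depth :: "'p outer \<Rightarrow> nat" where
  "depth (DiaC \<alpha>) = 0"
| "depth (ONot \<phi>) = depth \<phi>"
| "depth (OAnd \<phi> \<psi>) = max (depth \<phi>) (depth \<psi>)"
| "depth (DiaArg p \<phi>) = 1 + depth \<phi>"
| "depth (Dia \<phi>) = 1 + depth \<phi>"

primrec inner_args :: "'p inner \<Rightarrow> 'p set" where
  "inner_args (Atom p) = {p}"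
| "inner_args (INot \<alpha>) = inner_args \<alpha>"
| "inner_args (IImp \<alpha> \<beta>) = inner_args \<alpha> \<union> inner_args \<beta>"

text \<open>The label \<open>p\<close> of a modality \<open>DiaArg p\<close> does not count as an occurrence of \<open>p\<close>.\<close>

primrec args :: "'p outer \<Rightarrow> 'p set" where
  "args (DiaC \<alpha>) = inner_args \<alpha>"
| "args (ONot \<phi>) = args \<phi>"
| "args (OAnd \<phi> \<psi>) = args \<phi> \<union> args \<psi>"
| "args (DiaArg p \<phi>) = args \<phi>"
| "args (Dia \<phi>) = args \<phi>"

primrec vicinity :: "('a, 'p) basis \<Rightarrow> 'p set \<Rightarrow> nat \<Rightarrow> 'p set" where
  "vicinity V \<Phi> 0 = \<Phi>"
| "vicinity V \<Phi> (Suc n) = vicinity V \<Phi> n \<union>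
     {p. \<exists>r \<in> vicinity V \<Phi> n. {(p, r), (r, p)} \<inter> (\<Union>a. V a) \<noteq> {}}"

definition shrink :: "'p outer \<Rightarrow> ('a, 'p) basis \<Rightarrow> ('a, 'p) basis" where
  "shrink \<phi> V = (\<lambda>a. restr (V a) (vicinity V (args \<phi>) (depth \<phi>)))"

definition components :: "'p graph \<Rightarrow> 'p set set" where
  "components q = fst q // {(x, y) \<in> fst q \<times> fst q. (x, y) \<in> (snd q \<union> (snd q)\<inverse>)\<^sup>*}"

definition component_part :: "'p graph \<Rightarrow> 'p set \<Rightarrow> 'p graph" where
  "component_part q \<Phi> =
     (let T = \<Union>{X \<in> components q. X \<inter> \<Phi> \<noteq> {}} in (T, restr (snd q) T))"

definition n_bisimilar_modulo ::
  "nat \<Rightarrow> 'p set \<Rightarrow> 'p kripke \<Rightarrow> 'p graph \<Rightarrow> 'p kripke \<Rightarrow> 'p graph \<Rightarrow> bool" where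
  "n_bisimilar_modulo n \<Phi> K q K' q' \<longleftrightarrow>
     (\<exists>Z :: nat \<Rightarrow> ('p graph \<times> 'p graph) set.
        Z 0 \<subseteq> worlds K \<times> worlds K' \<and>
        (\<forall>i < n. Z (Suc i) \<subseteq> Z i) \<and>
        (q, q') \<in> Z n \<and>
        (\<forall>(v, v') \<in> Z 0. component_part v \<Phi> = component_part v' \<Phi>) \<and>
        (\<forall>i < n. \<forall>(v, v') \<in> Z (Suc i). \<forall>s u. (v, u) \<in> rel K s \<longrightarrow>
           (\<exists>u'. (v', u') \<in> rel K' s \<and> (u, u') \<in> Z i)) \<and>
        (\<forall>i < n. \<forall>(v, v') \<in> Z (Suc i). \<forall>s u'. (v', u') \<in> rel K' s \<longrightarrow>
           (\<exists>u. (v, u) \<in> rel K s \<and> (u, u') \<in> Z i)))"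

end

(* The shrunken basis only loses the edges leaving D, the vicinity of radius n = d(phi). After at most n
   moves a point has at most n arguments, so any argument connected to args phi is reached by a
   path of fewer than n edges and lies in D; its component is therefore unaffected by deleting the
   edges outside D x D. Hence relating (S, E), where card S + i <= n, to (S, E Int D x D) at level i
   is a bisimulation: moves are matched by intersecting the update with D x D and, conversely,
   by adding to it the edges on which all agents agree. *)

theory Submission
  imports Defs
begin

text \<open>Pigeonhole on the layers: a layer that misses something reachable from \<open>A\<close>
  is followed by one with at least one more reachable element, and at most \<open>card S\<close>
  elements are reachable.\<close>

lemma rtrancl_Image_subset_layer:
  assumes "finite S" "R \<subseteq> S \<times> S" "A \<subseteq> S" "A \<subseteq> f 0"
    and mono: "\<And>k. f k \<subseteq> f (Suc k)" and step: "\<And>k. R `` f k \<subseteq> f (Suc k)"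
    and "card S \<le> n"
  shows "R\<^sup>* `` A \<subseteq> f n"
proof (cases "A = {}")
  case False
  let ?T = "R\<^sup>* `` A"
  have T_S: "?T \<subseteq> S"
    using assms(2,3) by (auto elim: rtranclE)
  have fin: "finite ?T"
    using T_S assms(1) by (rule finite_subset)
  \<comment> \<open>A layer that gains no new reachable argument is closed under \<open>R\<close>.\<close>
  have layer: "?T \<subseteq> f k \<or> k < card (f k \<inter> ?T)" for k
  proof (induction k)
    case 0
    have "f 0 \<inter> ?T \<noteq> {}" using False assms(4) by blast
    then show ?case using fin by (simp add: card_gt_0_iff)
  next
    case (Suc k)
    show ?case
    proof (cases "?T \<subseteq> f k")
      case True
      then show ?thesis using mono by blast
    next
      case not_sub: False
      have "f k \<inter> ?T \<noteq> f (Suc k) \<inter> ?T"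
      proof
        assume eq: "f k \<inter> ?T = f (Suc k) \<inter> ?T"
        have "A \<subseteq> f k"
          using assms(4) mono lift_Suc_mono_le[of f 0 k] by blast
        have "y \<in> f k" if "(x, y) \<in> R\<^sup>*" "x \<in> A" for x y
          using that
        proof (induction rule: rtrancl_induct)
          case base
          then show ?case using \<open>A \<subseteq> f k\<close> by blast
        next
          case (step y z)
          then have "z \<in> f (Suc k) \<inter> ?T"
            using assms(6)[of k] by (blast intro: rtrancl_into_rtrancl)
          then show ?case using eq by blast
        qed
        then show False using not_sub by blast
      qed
      then have "f k \<inter> ?T \<subset> f (Suc k) \<inter> ?T"
        using mono[of k] by blast
      then have "card (f k \<inter> ?T) < card (f (Suc k) \<inter> ?T)"
        using fin by (intro psubset_card_mono) auto
      then show ?thesis using Suc not_sub by auto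
    qed
  qed
  \<comment> \<open>Reachable elements lie in \<open>S\<close>, so the alternative
    \<open>n < card (f n \<inter> ?T)\<close> is impossible.\<close>
  have "card (f n \<inter> ?T) \<le> n"
    using card_mono[OF assms(1), of "f n \<inter> ?T"] T_S assms(7) by (meson inf.coboundedI2 le_trans)
  then show ?thesis using layer[of n] by auto
qed simp

text \<open>Turns the quotient into reachability, so that induction along paths applies. The closure
  of the symmetrised edges is an equivalence, and its paths from \<open>S\<close> stay in
  \<open>S\<close>.\<close>

lemma Union_components:
  assumes "E \<subseteq> S \<times> S"
  shows "\<Union>{X \<in> components (S, E). X \<inter> \<Phi> \<noteq> {}} = (E \<union> E\<inverse>)\<^sup>* `` (S \<inter> \<Phi>)"
proof -
  let ?R = "E \<union> E\<inverse>"
  have S: "y \<in> S" if "(x, y) \<in> ?R\<^sup>*" "x \<in> S" for x y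
    using that assms by (auto elim: rtranclE)
  have sym: "(y, x) \<in> ?R\<^sup>*" if "(x, y) \<in> ?R\<^sup>*" for x y
    using that sym_rtrancl[of ?R] sym_Un_converse[of E] by (blast dest: symD)
  show ?thesis
  proof (intro equalityI subsetI)
    fix y assume "y \<in> \<Union>{X \<in> components (S, E). X \<inter> \<Phi> \<noteq> {}}"
    \<comment> \<open>The representative \<open>x\<close> may lie outside \<open>\<Phi>\<close>; the
      path that is needed runs from \<open>z\<close> back to \<open>x\<close> and on to
      \<open>y\<close>.\<close>
    then obtain x z where "x \<in> S" "z \<in> S" "z \<in> \<Phi>" "(x, z) \<in> ?R\<^sup>*" "(x, y) \<in> ?R\<^sup>*"
      unfolding components_def quotient_def by auto
    then show "y \<in> ?R\<^sup>* `` (S \<inter> \<Phi>)"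
      using sym rtrancl_trans by (metis IntI ImageI)
  next
    fix y assume "y \<in> ?R\<^sup>* `` (S \<inter> \<Phi>)"
    then obtain x where "x \<in> S" "x \<in> \<Phi>" "(x, y) \<in> ?R\<^sup>*" by blast
    moreover from this have "y \<in> S" using S by blast
    ultimately show "y \<in> \<Union>{X \<in> components (S, E). X \<inter> \<Phi> \<noteq> {}}"
      unfolding components_def quotient_def by auto
  qed
qed

lemma component_part_eq:
  assumes "E \<subseteq> S \<times> S"
  shows "component_part (S, E) \<Phi> =
    ((E \<union> E\<inverse>)\<^sup>* `` (S \<inter> \<Phi>), restr E ((E \<union> E\<inverse>)\<^sup>* `` (S \<inter> \<Phi>)))"
  using Union_components[OF assms] by (simp add: component_part_def Let_def)

text \<open>Every argument on a path from \<open>S \<inter> \<Phi>\<close> is itself reachable,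
  hence in \<open>D\<close>, so no edge of the path is deleted.\<close>

lemma component_part_restr:
  assumes "E \<subseteq> S \<times> S" and sub: "(E \<union> E\<inverse>)\<^sup>* `` (S \<inter> \<Phi>) \<subseteq> D"
  shows "component_part (S, restr E D) \<Phi> = component_part (S, E) \<Phi>"
proof -
  let ?R = "E \<union> E\<inverse>" and ?R' = "restr E D \<union> (restr E D)\<inverse>"
  have "(x, y) \<in> ?R'\<^sup>*" if "(x, y) \<in> ?R\<^sup>*" "x \<in> S \<inter> \<Phi>" for x y
    using that
  proof (induction rule: rtrancl_induct)
    case (step y z)
    then have "y \<in> D" "z \<in> D"
      using sub by (blast intro: rtrancl_into_rtrancl)+
    with step have "(y, z) \<in> ?R'" unfolding restr_def by blast
    with step show ?case by (blast intro: rtrancl_into_rtrancl)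
  qed simp
  moreover have "?R'\<^sup>* \<subseteq> ?R\<^sup>*"
    by (rule rtrancl_mono) (auto simp: restr_def)
  ultimately have "?R'\<^sup>* `` (S \<inter> \<Phi>) = ?R\<^sup>* `` (S \<inter> \<Phi>)" by blast
  moreover have "restr (restr E D) T = restr E T" if "T \<subseteq> D" for T
    using that unfolding restr_def by blast
  moreover have "restr E D \<subseteq> S \<times> S"
    using assms(1) unfolding restr_def by blast
  ultimately show ?thesis
    using assms by (simp add: component_part_eq)
qed

text \<open>Each edge of \<open>E\<close> belongs to some \<open>V a\<close>, so following it
  advances by at most one vicinity layer; with at most \<open>n\<close> arguments, \<open>n\<close>
  layers suffice.\<close>

lemma component_part_restr_vicinity:
  assumes "(S, E) \<in> points V" "finite S" "card S \<le> n"
  shows "component_part (S, restr E (vicinity V \<Phi> n)) \<Phi> = component_part (S, E) \<Phi>"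
proof (rule component_part_restr)
  have "E \<subseteq> (\<Union>a. restr (V a) S)"
    using assms(1) unfolding points_def by simp
  then have E: "E \<subseteq> (\<Union>a. V a)" and S: "E \<subseteq> S \<times> S"
    unfolding restr_def by blast+
  show "E \<subseteq> S \<times> S" by (fact S)
  show "(E \<union> E\<inverse>)\<^sup>* `` (S \<inter> \<Phi>) \<subseteq> vicinity V \<Phi> n"
  proof (rule rtrancl_Image_subset_layer[where S = S])
    show "E \<union> E\<inverse> \<subseteq> S \<times> S" using S by blast
    show "(E \<union> E\<inverse>) `` vicinity V \<Phi> k \<subseteq> vicinity V \<Phi> (Suc k)" for k
    proof
      fix y assume "y \<in> (E \<union> E\<inverse>) `` vicinity V \<Phi> k"
      then obtain x where "x \<in> vicinity V \<Phi> k" "(x, y) \<in> E \<or> (y, x) \<in> E" by blast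
      moreover from this have "{(y, x), (x, y)} \<inter> (\<Union>a. V a) \<noteq> {}" using E by blast
      ultimately show "y \<in> vicinity V \<Phi> (Suc k)" unfolding vicinity.simps by blast
    qed
  qed (use assms in auto)
qed

text \<open>The update alone meets the lower bound on the enlarged argument set; old edges stay
  below the upper bound, which grows with that set.\<close>

lemma succ_arg_points:
  assumes "q \<in> points V" "q' \<in> succ_arg V p q"
  shows "q' \<in> points V"
proof -
  obtain S E where q: "q = (S, E)" by (cases q)
  obtain X where X: "(\<Inter>a. restr (V a) (S \<union> {p})) \<subseteq> X" "X \<subseteq> (\<Union>a. restr (V a) (S \<union> {p}))"
    and q': "q' = (S \<union> {p}, E \<union> X)"
    using assms(2) unfolding q succ_arg_def updates_def by auto
  have "E \<subseteq> (\<Union>a. restr (V a) S)"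
    using assms(1) unfolding q points_def by simp
  also have "\<dots> \<subseteq> (\<Union>a. restr (V a) (S \<union> {p}))"
    by (rule UN_mono) (auto simp: restr_def)
  finally show ?thesis
    using X unfolding q' points_def by (simp add: le_supI2)
qed

text \<open>Restriction to \<open>D\<close> commutes with restriction to \<open>S\<close> and with
  intersections and unions over the agents, so both bounds survive.\<close>

lemma restr_points:
  fixes V :: "('a, 'p) basis"
  assumes "(S, E) \<in> points V"
  shows "(S, restr E D) \<in> points (\<lambda>a. restr (V a) D)"
  using assms unfolding points_def restr_def by auto

lemma restr_succ_arg:
  fixes V :: "('a, 'p) basis"
  assumes "(S', E') \<in> succ_arg V p (S, E)"
  shows "(S', restr E' D) \<in> succ_arg (\<lambda>a. restr (V a) D) p (S, restr E D)"
proof -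
  obtain X where "X \<in> updates V (S, E) p" and eq: "S' = S \<union> {p}" "E' = E \<union> X"
    using assms unfolding succ_arg_def by auto
  then have "restr X D \<in> updates (\<lambda>a. restr (V a) D) (S, restr E D) p"
    unfolding updates_def restr_def by auto
  moreover have "restr E' D = restr E D \<union> restr X D"
    unfolding eq restr_def by blast
  ultimately show ?thesis unfolding succ_arg_def eq by auto
qed

text \<open>An update over the shrunken basis may lack edges outside \<open>D \<times> D\<close> on
  which all agents agree, so it is enlarged by these to become an update over
  \<open>V\<close>.\<close>

lemma succ_arg_restr_lift:
  fixes V :: "('a, 'p) basis"
  assumes "(S', F) \<in> succ_arg (\<lambda>a. restr (V a) D) p (S, restr E D)"
  obtains E' where "(S', E') \<in> succ_arg V p (S, E)" "F = restr E' D"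
proof -
  obtain X where X: "X \<in> updates (\<lambda>a. restr (V a) D) (S, restr E D) p"
    and eq: "S' = S \<union> {p}" "F = restr E D \<union> X"
    using assms unfolding succ_arg_def by auto
  let ?Y = "X \<union> (\<Inter>a. restr (V a) (S \<union> {p}))"
  have "?Y \<in> updates V (S, E) p"
  proof -
    have "X \<subseteq> (\<Union>a. restr (restr (V a) D) (S \<union> {p}))"
      using X unfolding updates_def by simp
    also have "\<dots> \<subseteq> (\<Union>a. restr (V a) (S \<union> {p}))"
      by (rule UN_mono) (auto simp: restr_def)
    finally have "X \<subseteq> (\<Union>a. restr (V a) (S \<union> {p}))" .
    \<comment> \<open>Holds because there is at least one agent.\<close>
    moreover have "(\<Inter>a. restr (V a) (S \<union> {p})) \<subseteq> (\<Union>a. restr (V a) (S \<union> {p}))"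
      by (rule INF_le_SUP) simp
    ultimately show ?thesis unfolding updates_def by simp
  qed
  then have "(S', E \<union> ?Y) \<in> succ_arg V p (S, E)"
    unfolding succ_arg_def eq by auto
  \<comment> \<open>The added edges inside \<open>D \<times> D\<close> are already in
    \<open>X\<close> by its lower bound, and \<open>X\<close> itself is contained in
    \<open>D \<times> D\<close>.\<close>
  moreover have "F = restr (E \<union> ?Y) D"
    using X unfolding eq updates_def restr_def by auto
  ultimately show ?thesis by (rule that)
qed

text \<open>Treats both kinds of symbol uniformly: a move along \<open>Exists\<close> is a move
  along some \<open>p\<close>, and can be answered with the same \<open>p\<close>.\<close>

lemma accessibility_iff:
  "(q, q') \<in> accessibility V s \<longleftrightarrow>
     q \<in> points V \<and> (\<exists>p. (s = Arg p \<or> s = Exists) \<and> q' \<in> succ_arg V p q)"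
  by (cases s) (auto simp: succ_any_def)

lemma succ_arg_card:
  assumes "(S', E') \<in> succ_arg V p (S, E)" "finite S"
  shows "finite S'" "card S' \<le> Suc (card S)"
  using assms unfolding succ_arg_def by (auto simp: card_insert_if)

text \<open>The formula matters only through its depth and its arguments, so an arbitrary number and
  set take their place.\<close>

lemma n_bisimilar_modulo_restr_vicinity:
  fixes V :: "('a, 'p) basis" and \<Phi> :: "'p set" and n :: nat
  defines "D \<equiv> vicinity V \<Phi> n"
  shows "n_bisimilar_modulo n \<Phi>
    (deliberative_model \<sigma> V) ({}, {})
    (deliberative_model \<sigma> (\<lambda>a. restr (V a) D)) ({}, {})"
proof -
  let ?V' = "\<lambda>a. restr (V a) D"
  \<comment> \<open>Level \<open>i\<close> counts the moves left. A move adds at most one argument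
    and uses up one level, so \<open>card S + i \<le> n\<close> persists; it forces \<open>S\<close>
    to be empty at level \<open>n\<close> and gives \<open>card S \<le> n\<close> at level
    0.\<close>
  define Z where "Z i = {((S, E), (S, restr E D)) | S E.
    (S, E) \<in> points V \<and> finite S \<and> card S + i \<le> n}" for i
  have ZI: "((S, E), (S, restr E D)) \<in> Z i"
    if "(S, E) \<in> points V" "finite S" "card S + i \<le> n" for S E i
    using that unfolding Z_def by blast
  have ZE: "\<exists>S E. v = (S, E) \<and> v' = (S, restr E D) \<and>
      (S, E) \<in> points V \<and> finite S \<and> card S + i \<le> n"
    if "(v, v') \<in> Z i" for v v' i
    using that unfolding Z_def by blast
  have succ: "((S', E'), (S', restr E' D)) \<in> Z i"
    if "(S, E) \<in> points V" "finite S" "card S + Suc i \<le> n"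
      "(S', E') \<in> succ_arg V p (S, E)" for S E S' E' p i
    using that succ_arg_points[OF that(1,4)] succ_arg_card[OF that(4,2)] by (intro ZI) auto
  have worlds: "Z 0 \<subseteq> points V \<times> points ?V'"
    unfolding Z_def by (auto intro: restr_points)
  have antimono: "Z (Suc i) \<subseteq> Z i" for i
    unfolding Z_def by fastforce
  have init: "(({}, {}), ({}, {})) \<in> Z n"
    unfolding Z_def by (auto simp: points_def restr_def)
  have parts: "component_part v \<Phi> = component_part v' \<Phi>" if "(v, v') \<in> Z 0" for v v'
    using ZE[OF that] component_part_restr_vicinity[of _ _ V n \<Phi>] unfolding D_def by auto
  have zig: "\<exists>u'. (v', u') \<in> accessibility ?V' s \<and> (u, u') \<in> Z i"
    if Zv: "(v, v') \<in> Z (Suc i)" and acc: "(v, u) \<in> accessibility V s" for v v' u s i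
  proof -
    obtain S E where v: "v = (S, E)" "v' = (S, restr E D)"
      "(S, E) \<in> points V" "finite S" "card S + Suc i \<le> n"
      using ZE[OF Zv] by blast
    obtain p where p: "s = Arg p \<or> s = Exists" "u \<in> succ_arg V p (S, E)"
      using acc unfolding accessibility_iff v(1) by blast
    obtain S' E' where u: "u = (S', E')" by (cases u)
    show ?thesis
      using restr_succ_arg[of S' E' V p S E D] restr_points[OF v(3)] succ[OF v(3-5)] p
      unfolding accessibility_iff v(1,2) u by blast
  qed
  have zag: "\<exists>u. (v, u) \<in> accessibility V s \<and> (u, u') \<in> Z i"
    if Zv: "(v, v') \<in> Z (Suc i)" and acc: "(v', u') \<in> accessibility ?V' s" for v v' u' s i
  proof -
    obtain S E where v: "v = (S, E)" "v' = (S, restr E D)"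
      "(S, E) \<in> points V" "finite S" "card S + Suc i \<le> n"
      using ZE[OF Zv] by blast
    obtain p where p: "s = Arg p \<or> s = Exists" "u' \<in> succ_arg ?V' p (S, restr E D)"
      using acc unfolding accessibility_iff v(2) by blast
    obtain S' F where u': "u' = (S', F)" by (cases u')
    \<comment> \<open>The lift starts from the full edge set \<open>E\<close>, so its result is a
      successor of \<open>v\<close>.\<close>
    obtain E' where E': "(S', E') \<in> succ_arg V p (S, E)" "F = restr E' D"
      using p(2) unfolding u' by (rule succ_arg_restr_lift)
    show ?thesis
      using E'(1) succ[OF v(3-5) E'(1)] p(1) v(3)
      unfolding accessibility_iff v(1) u' E'(2) by blast
  qed
  show ?thesis
    unfolding n_bisimilar_modulo_def deliberative_model_def kripke.simps
    by (intro exI[of _ Z] conjI ballI allI impI case_prodI2 worlds antimono init)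
      (blast intro: parts zig zag)+
qed

theorem theorem1:
  fixes \<sigma> :: "('p :: {countable, infinite}) graph \<Rightarrow> 'p set set"
    and V :: "('a :: finite, 'p) basis"
    and \<phi> :: "'p outer"
  assumes "argumentation_semantics \<sigma>"
  shows "n_bisimilar_modulo (depth \<phi>) (args \<phi>)
           (deliberative_model \<sigma> V) ({}, {})
           (deliberative_model \<sigma> (shrink \<phi> V)) ({}, {})"
  unfolding shrink_def by (rule n_bisimilar_modulo_restr_vicinity)

end
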